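(* Let the data fidelity $H$ be given by either $$H(f^\delta,Tu)=\left\|\frac{f^\delta}{Tu}-1\right\|_{L^2(\Omega)}^2\qquad\text{or}\qquad H(f^\delta,Tu)=\int_\Omega\left(\frac{f^\delta}{Tu}+\log(Tu)-\log(f^\delta)-1\right).$$ Suppose that the penalty $J$ satisfies $$J(uv)\le J(u)+J(v),\qquad J(u)=J\left(\frac1u\right),\qquad J(1)=0\qquad\text{for any }u,v\in\operatorname{dom}J,$$ that $H(f^\delta,f)\le\delta^2$ with $\delta>0$, and that the iterates $x_k$ of the multiplicative multiscale hierarchical decomposition method (MHDM) for the data $f^\delta$ are well-defined. Let $\tau>1$ and $k^*(\delta):=\max\{k\in\mathbb{N}:\ H(f^\delta,Tx_k)\ge\tau\delta^2\}$. If $(k^*(\delta))$ is unbounded as $\delta\to0$, then $(Tx_{k^*(\delta)})$ converges a.e. to $f$ on a subsequence. In particular, for the denoising case ($T=I$), one has a.e. convergence of $(x_{k^*(\delta)})$ on a subsequence to the true image $z$.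
   Context: $\Omega\subseteq\mathbb{R}^2$ is a domain, $T:L^2(\Omega)\to L^2(\Omega)$ is a bounded linear operator, $f\in L^2(\Omega)$ is the exact data, $f^\delta$ is the noisy data for noise level $\delta>0$, and $z$ is a clean image satisfying $Tz=f$ and $J(z)<\infty$, where $J:L^2(\Omega)\to[0,\infty]$ is a proper function (the penalty) and $\operatorname{dom}J=\{u\in L^2(\Omega):J(u)<\infty\}$. The assumed properties of $J$ are understood to include that $uv$ and $1/u$ make sense and belong to $\operatorname{dom}J$ for $u,v\in\operatorname{dom}J$. The quotients and logarithms in $H$ are assumed to make sense: $f$, $f^\delta$ and the functions $Tu$ at which $H$ is evaluated are positive a.e. The quantities $f,z,T,J,H,\lambda_0,\tau$ do not depend on $\delta$. Multiplicative MHDM (for given $f^\delta$): let $\lambda_0>0$ and $\lambda_{k+1}=2\lambda_k$ for $k\ge0$; set $x_{-1}=1$ and, for $k\ge0$, $x_k=\prod_{j=0}^{k}u_j$, where $$u_k\in\arg\min_uE_k(u),\qquad E_k(u)=\lambda_kH(f^\delta,T(ux_{k-1}))+J(u).$$ "The iterates are well-defined" means that for every $k\ge0$ such a minimizer $u_k$ exists (not necessarily unique; some choice is fixed) and all expressions $Tx_k$, $H(f^\delta,Tx_k)$ make sense. The minimization is over all $u\in L^2(\Omega)$ for which $E_k(u)$ makes sense. *)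

theory Defs
  imports "HOL-Analysis.Analysis"
begin

text \<open>
  Elements of \<open>L\<^sup>2(\<Omega>)\<close> are represented by real functions on the plane, of which only the
  restriction to \<open>\<Omega>\<close> matters, up to equality almost everywhere. Operators and functionals on
  \<open>L\<^sup>2(\<Omega>)\<close> act on representatives and have to respect almost everywhere equality.
\<close>

type_synonym img = "real^2 \<Rightarrow> real"

definition L2 :: "(real^2) set \<Rightarrow> img set" where
  "L2 \<Omega> = {u \<in> borel_measurable (lebesgue_on \<Omega>). integrable (lebesgue_on \<Omega>) (\<lambda>p. (u p)\<^sup>2)}"

definition L2_norm :: "(real^2) set \<Rightarrow> img \<Rightarrow> real" where
  "L2_norm \<Omega> u = sqrt (\<integral>p. (u p)\<^sup>2 \<partial>lebesgue_on \<Omega>)"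

text \<open>Compatibility with almost everywhere equality follows from linearity and boundedness here.\<close>

definition bounded_linear_L2 :: "(real^2) set \<Rightarrow> (img \<Rightarrow> img) \<Rightarrow> bool" where
  "bounded_linear_L2 \<Omega> T \<longleftrightarrow>
     (\<forall>u\<in>L2 \<Omega>. T u \<in> L2 \<Omega>) \<and>
     (\<forall>u\<in>L2 \<Omega>. \<forall>v\<in>L2 \<Omega>. AE p in lebesgue_on \<Omega>. T (\<lambda>q. u q + v q) p = T u p + T v p) \<and>
     (\<forall>c. \<forall>u\<in>L2 \<Omega>. AE p in lebesgue_on \<Omega>. T (\<lambda>q. c * u q) p = c * T u p) \<and>
     (\<exists>C. \<forall>u\<in>L2 \<Omega>. L2_norm \<Omega> (T u) \<le> C * L2_norm \<Omega> u)"

definition dom_J :: "(real^2) set \<Rightarrow> (img \<Rightarrow> ennreal) \<Rightarrow> img set" where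
  "dom_J \<Omega> J = {u \<in> L2 \<Omega>. J u < \<infinity>}"

definition proper_functional :: "(real^2) set \<Rightarrow> (img \<Rightarrow> ennreal) \<Rightarrow> bool" where
  "proper_functional \<Omega> J \<longleftrightarrow>
     (\<forall>u\<in>L2 \<Omega>. \<forall>v\<in>L2 \<Omega>. (AE p in lebesgue_on \<Omega>. u p = v p) \<longrightarrow> J u = J v) \<and>
     dom_J \<Omega> J \<noteq> {}"

text \<open>
  That \<open>1/u\<close> makes sense means that \<open>u\<close> is nonzero almost everywhere; this has to be said
  separately because division by zero is total. The constant \<open>1\<close> lies in \<open>L\<^sup>2(\<Omega>)\<close> as soon as
  the domain of \<open>J\<close> is nonempty, since it is \<open>u \<cdot> (1/u)\<close> almost everywhere.
\<close>

definition multiplicative_penalty :: "(real^2) set \<Rightarrow> (img \<Rightarrow> ennreal) \<Rightarrow> bool" where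
  "multiplicative_penalty \<Omega> J \<longleftrightarrow>
     (\<forall>u\<in>dom_J \<Omega> J. \<forall>v\<in>dom_J \<Omega> J.
        (\<lambda>p. u p * v p) \<in> dom_J \<Omega> J \<and> J (\<lambda>p. u p * v p) \<le> J u + J v) \<and>
     (\<forall>u\<in>dom_J \<Omega> J.
        (AE p in lebesgue_on \<Omega>. u p \<noteq> 0) \<and>
        (\<lambda>p. 1 / u p) \<in> dom_J \<Omega> J \<and> J u = J (\<lambda>p. 1 / u p)) \<and>
     J (\<lambda>p. 1) = 0"

text \<open>
  The fidelities take values in \<open>[0,\<infinity>]\<close>: \<open>H_quot\<close> is infinite if the relative residual is
  not in \<open>L\<^sup>2(\<Omega>)\<close>, and the integrand of \<open>H_log\<close> is nonnegative wherever \<open>g\<close> and \<open>w\<close> are positive.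
\<close>

definition H_quot :: "(real^2) set \<Rightarrow> img \<Rightarrow> img \<Rightarrow> ennreal" where
  "H_quot \<Omega> g w = (\<integral>\<^sup>+p. ennreal ((g p / w p - 1)\<^sup>2) \<partial>lebesgue_on \<Omega>)"

definition H_log :: "(real^2) set \<Rightarrow> img \<Rightarrow> img \<Rightarrow> ennreal" where
  "H_log \<Omega> g w = (\<integral>\<^sup>+p. ennreal (g p / w p + ln (w p) - ln (g p) - 1) \<partial>lebesgue_on \<Omega>)"

definition mhdm_iterate :: "(nat \<Rightarrow> img) \<Rightarrow> nat \<Rightarrow> img" where
  "mhdm_iterate u k = (\<lambda>p. \<Prod>j\<le>k. u j p)"

text \<open>\<open>mhdm_prev u k\<close> is \<open>x\<^bsub>k-1\<^esub>\<close>, with \<open>x\<^bsub>-1\<^esub> = 1\<close>.\<close>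

definition mhdm_prev :: "(nat \<Rightarrow> img) \<Rightarrow> nat \<Rightarrow> img" where
  "mhdm_prev u k = (case k of 0 \<Rightarrow> (\<lambda>p. 1) | Suc j \<Rightarrow> mhdm_iterate u j)"

definition mhdm_energy ::
    "(img \<Rightarrow> img) \<Rightarrow> (img \<Rightarrow> img \<Rightarrow> ennreal) \<Rightarrow> (img \<Rightarrow> ennreal) \<Rightarrow> img \<Rightarrow> real \<Rightarrow> img \<Rightarrow> img \<Rightarrow> ennreal"
  where
  "mhdm_energy T H J g l x v = ennreal l * H g (T (\<lambda>p. v p * x p)) + J v"

text \<open>The \<open>v\<close> for which the energy makes sense.\<close>

definition mhdm_admissible :: "(real^2) set \<Rightarrow> (img \<Rightarrow> img) \<Rightarrow> img \<Rightarrow> img \<Rightarrow> bool" where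
  "mhdm_admissible \<Omega> T x v \<longleftrightarrow>
     v \<in> L2 \<Omega> \<and> (\<lambda>p. v p * x p) \<in> L2 \<Omega> \<and>
     (AE p in lebesgue_on \<Omega>. 0 < T (\<lambda>q. v q * x q) p)"

definition mhdm_factors ::
    "(real^2) set \<Rightarrow> (img \<Rightarrow> img) \<Rightarrow> (img \<Rightarrow> img \<Rightarrow> ennreal) \<Rightarrow> (img \<Rightarrow> ennreal) \<Rightarrow> (nat \<Rightarrow> real) \<Rightarrow>
     img \<Rightarrow> (nat \<Rightarrow> img) \<Rightarrow> bool"
  where
  "mhdm_factors \<Omega> T H J lam g u \<longleftrightarrow>
     (\<forall>k. is_arg_min (mhdm_energy T H J g (lam k) (mhdm_prev u k))
            (mhdm_admissible \<Omega> T (mhdm_prev u k)) (u k))"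

definition stop_set ::
    "(img \<Rightarrow> img) \<Rightarrow> (img \<Rightarrow> img \<Rightarrow> ennreal) \<Rightarrow> real \<Rightarrow> real \<Rightarrow> img \<Rightarrow> (nat \<Rightarrow> img) \<Rightarrow> nat set"
  where
  "stop_set T H \<tau> \<delta> g u = {k. ennreal (\<tau> * \<delta>\<^sup>2) \<le> H g (T (mhdm_iterate u k))}"

text \<open>
  The maximum only makes sense for a finite nonempty set. The set is typically empty for large
  noise levels, so nonemptiness has to be stated wherever \<open>k_star\<close> is used.
\<close>

definition k_star ::
    "(img \<Rightarrow> img) \<Rightarrow> (img \<Rightarrow> img \<Rightarrow> ennreal) \<Rightarrow> real \<Rightarrow> real \<Rightarrow> img \<Rightarrow> (nat \<Rightarrow> img) \<Rightarrow> nat"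
  where
  "k_star T H \<tau> \<delta> g u = Max (stop_set T H \<tau> \<delta> g u)"

end

theory Submission imports Defs begin

text \<open>
  Write \<open>h\<^sub>k = H(f\<^sup>\<delta>, T x\<^sub>k)\<close>. Testing the minimality of \<open>u\<^sub>k\<close> against \<open>z / x\<^bsub>k-1\<^esub>\<close> gives
  \<open>\<lambda>\<^sub>k h\<^sub>k + J(u\<^sub>k) \<le> \<lambda>\<^sub>k \<delta>\<^sup>2 + J(z / x\<^bsub>k-1\<^esub>)\<close>, and \<open>J(z / x\<^sub>k) \<le> J(z / x\<^bsub>k-1\<^esub>) + J(u\<^sub>k)\<close>. After division
  by \<open>2\<^sup>k\<close> these estimates telescope to \<open>\<lambda>\<^sub>0 \<Sum>\<^bsub>j\<le>k\<^esub> (h\<^sub>j - \<delta>\<^sup>2) \<le> 2 J(z)\<close>. Testing against \<open>1\<close> shows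
  that \<open>h\<close> is nonincreasing, so \<open>\<lambda>\<^sub>0 (k + 1) (h\<^sub>k - \<delta>\<^sup>2) \<le> 2 J(z)\<close>. Hence the stopping set is finite, and
  \<open>h\<close> at the stopping index tends to \<open>0\<close> along a subsequence on which the index tends to infinity.
  Both fidelities then force \<open>f\<^sup>\<delta> / T x \<longrightarrow> 1\<close> and \<open>f\<^sup>\<delta> / f \<longrightarrow> 1\<close> a.e. on a further subsequence.
\<close>

section \<open>Compatibility with almost everywhere equality\<close>

lemma L2_cong_AE:
  assumes "u \<in> L2 \<Omega>" "v \<in> borel_measurable (lebesgue_on \<Omega>)" "AE p in lebesgue_on \<Omega>. u p = v p"
  shows "v \<in> L2 \<Omega>"
proof -
  have "integrable (lebesgue_on \<Omega>) (\<lambda>p. (u p)\<^sup>2) \<longleftrightarrow> integrable (lebesgue_on \<Omega>) (\<lambda>p. (v p)\<^sup>2)"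
    using assms by (intro integrable_cong_AE) (auto simp: L2_def)
  with assms show ?thesis by (simp add: L2_def)
qed

lemma L2_add:
  assumes "u \<in> L2 \<Omega>" "v \<in> L2 \<Omega>"
  shows "(\<lambda>p. u p + v p) \<in> L2 \<Omega>"
proof -
  have [measurable]: "u \<in> borel_measurable (lebesgue_on \<Omega>)" "v \<in> borel_measurable (lebesgue_on \<Omega>)"
    using assms by (auto simp: L2_def)
  have "integrable (lebesgue_on \<Omega>) (\<lambda>p. 2 * (u p)\<^sup>2 + 2 * (v p)\<^sup>2)"
    using assms by (auto simp: L2_def)
  then have "integrable (lebesgue_on \<Omega>) (\<lambda>p. (u p + v p)\<^sup>2)"
  proof (rule Bochner_Integration.integrable_bound)
    show "AE p in lebesgue_on \<Omega>. norm ((u p + v p)\<^sup>2) \<le> norm (2 * (u p)\<^sup>2 + 2 * (v p)\<^sup>2)"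
    proof (rule AE_I2)
      fix p
      have "(u p + v p)\<^sup>2 \<le> 2 * (u p)\<^sup>2 + 2 * (v p)\<^sup>2"
        using sum_squares_bound[of "u p" "v p"] by (simp add: power2_sum)
      then show "norm ((u p + v p)\<^sup>2) \<le> norm (2 * (u p)\<^sup>2 + 2 * (v p)\<^sup>2)" by simp
    qed
  qed simp
  then show ?thesis by (simp add: L2_def)
qed

lemma L2_cmult: "u \<in> L2 \<Omega> \<Longrightarrow> (\<lambda>p. c * u p) \<in> L2 \<Omega>"
  by (auto simp: L2_def power_mult_distrib)

lemma L2_norm_eq_0_iff:
  assumes "u \<in> L2 \<Omega>"
  shows "L2_norm \<Omega> u = 0 \<longleftrightarrow> (AE p in lebesgue_on \<Omega>. u p = 0)"
  using assms integral_nonneg_eq_0_iff_AE[of "lebesgue_on \<Omega>" "\<lambda>p. (u p)\<^sup>2"]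
  by (simp add: L2_def L2_norm_def)

text \<open>The difference \<open>u - v\<close> has norm 0, so boundedness forces
  \<open>T (u - v)\<close> to have norm 0; linearity, itself known only a.e., then separates the two
  images.\<close>

lemma bounded_linear_L2_cong_AE:
  assumes T: "bounded_linear_L2 \<Omega> T" and u: "u \<in> L2 \<Omega>" and v: "v \<in> L2 \<Omega>"
    and eq: "AE p in lebesgue_on \<Omega>. u p = v p"
  shows "AE p in lebesgue_on \<Omega>. T u p = T v p"
proof -
  have T_add: "AE p in lebesgue_on \<Omega>. T (\<lambda>q. v q + w q) p = T v p + T w p"
    if "v \<in> L2 \<Omega>" "w \<in> L2 \<Omega>" for v w
    using T that by (simp add: bounded_linear_L2_def)
  have T_cmult: "AE p in lebesgue_on \<Omega>. T (\<lambda>q. c * v q) p = c * T v p" if "v \<in> L2 \<Omega>" for c v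
    using T that by (simp add: bounded_linear_L2_def)
  define w where "w = (\<lambda>p. u p + (- 1) * v p)"
  have mv: "(\<lambda>p. (- 1) * v p) \<in> L2 \<Omega>" by (rule L2_cmult[OF v])
  then have w: "w \<in> L2 \<Omega>" unfolding w_def by (rule L2_add[OF u])
  then have Tw: "T w \<in> L2 \<Omega>" using T by (simp add: bounded_linear_L2_def)
  obtain C where "L2_norm \<Omega> (T w) \<le> C * L2_norm \<Omega> w"
    using T w by (auto simp: bounded_linear_L2_def)
  moreover have "L2_norm \<Omega> w = 0"
    unfolding L2_norm_eq_0_iff[OF w] using eq by eventually_elim (simp add: w_def)
  moreover have "0 \<le> L2_norm \<Omega> (T w)" by (simp add: L2_norm_def)
  ultimately have "L2_norm \<Omega> (T w) = 0" by simp
  then have "AE p in lebesgue_on \<Omega>. T w p = 0" by (simp add: L2_norm_eq_0_iff[OF Tw])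
  moreover have "AE p in lebesgue_on \<Omega>. T w p = T u p + T (\<lambda>q. (- 1) * v q) p"
    unfolding w_def by (rule T_add[OF u mv])
  moreover have "AE p in lebesgue_on \<Omega>. T (\<lambda>q. (- 1) * v q) p = (- 1) * T v p"
    by (rule T_cmult[OF v])
  ultimately show ?thesis by eventually_elim simp
qed

text \<open>Provides both the starting value x_(-1) = 1 and the competitor 1 against which
  monotonicity of the fidelity is tested.\<close>

lemma one_in_L2:
  assumes "proper_functional \<Omega> J" "multiplicative_penalty \<Omega> J"
  shows "(\<lambda>p. 1) \<in> L2 \<Omega>"
proof -
  obtain u where u: "u \<in> dom_J \<Omega> J" using assms(1) by (auto simp: proper_functional_def)
  then have nz: "AE p in lebesgue_on \<Omega>. u p \<noteq> 0" and "(\<lambda>p. 1 / u p) \<in> dom_J \<Omega> J"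
    using assms(2) by (auto simp: multiplicative_penalty_def)
  moreover have "(\<lambda>p. v p * w p) \<in> dom_J \<Omega> J" if "v \<in> dom_J \<Omega> J" "w \<in> dom_J \<Omega> J" for v w
    using assms(2) that by (simp add: multiplicative_penalty_def)
  ultimately have "(\<lambda>p. u p * (1 / u p)) \<in> dom_J \<Omega> J"
    using u by blast
  then have "(\<lambda>p. u p * (1 / u p)) \<in> L2 \<Omega>" by (simp add: dom_J_def)
  then show ?thesis
  proof (rule L2_cong_AE)
    show "AE p in lebesgue_on \<Omega>. u p * (1 / u p) = 1" using nz by eventually_elim simp
  qed simp
qed

lemma H_cong_AE:
  assumes "H = H_quot \<Omega> \<or> H = H_log \<Omega>" "AE p in lebesgue_on \<Omega>. w p = w' p"
  shows "H g w = H g w'"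
  using assms(1)
proof
  assume "H = H_quot \<Omega>"
  moreover have "H_quot \<Omega> g w = H_quot \<Omega> g w'"
    unfolding H_quot_def by (rule nn_integral_cong_AE[OF eventually_mono[OF assms(2)]]) simp
  ultimately show ?thesis by simp
next
  assume "H = H_log \<Omega>"
  moreover have "H_log \<Omega> g w = H_log \<Omega> g w'"
    unfolding H_log_def by (rule nn_integral_cong_AE[OF eventually_mono[OF assms(2)]]) simp
  ultimately show ?thesis by simp
qed

text \<open>Here \<open>h k\<close> stands for the fidelity, \<open>j k\<close> for J(u_k),
  \<open>A k\<close> for J(z / x_(k-1)) and \<open>e\<close> for the squared noise level. Adding
  \<open>energy\<close> and \<open>A(2)\<close> cancels \<open>j k\<close> and leaves lam k * (h k -
  e) + A (k+1) \<le> 2 * A k. Since \<open>lam\<close> doubles exactly, division by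
  \<open>2 ^ k\<close> makes the weight of h k - e constant and the A-terms telescoping.\<close>

lemma doubling_telescope:
  fixes h A j lam :: "nat \<Rightarrow> real"
  assumes lam: "0 < lam 0" "\<And>k. lam (Suc k) = 2 * lam k"
    and energy: "\<And>k. lam k * h k + j k \<le> lam k * e + A k"
    and A: "\<And>k. 0 \<le> A k" "\<And>k. A (Suc k) \<le> A k + j k"
    and dec: "\<And>k. h (Suc k) \<le> h k"
  shows "lam 0 * (real k + 1) * (h k - e) \<le> 2 * A 0"
proof -
  have lam_eq: "lam k = 2 ^ k * lam 0" for k
    by (induction k) (simp_all add: lam(2))
  have step: "lam 0 * (h k - e) + 2 * (A (Suc k) / 2 ^ Suc k) \<le> 2 * (A k / 2 ^ k)" for k
  proof -
    have "2 ^ k * (lam 0 * (h k - e)) + A (Suc k) \<le> 2 * A k"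
      using energy[of k] A(2)[of k] unfolding lam_eq[of k] by (simp add: algebra_simps)
    from divide_right_mono[OF this, of "2 ^ k"] show ?thesis by (simp add: add_divide_distrib)
  qed
  have sum: "(\<Sum>i\<le>k. lam 0 * (h i - e)) + 2 * (A (Suc k) / 2 ^ Suc k) \<le> 2 * A 0" for k
  proof (induction k)
    case 0
    then show ?case using step[of 0] by simp
  next
    case (Suc k)
    then show ?case using step[of "Suc k"] by simp
  qed
  have "antimono h" using dec by (rule decseq_SucI)
  \<comment> \<open>As \<open>h\<close> is nonincreasing, the last of the k + 1 summands is the
    smallest.\<close>
  have "lam 0 * (real k + 1) * (h k - e) = (\<Sum>i\<le>k. lam 0 * (h k - e))" by (simp add: algebra_simps)
  also have "\<dots> \<le> (\<Sum>i\<le>k. lam 0 * (h i - e))"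
    using lam(1) antimonoD[OF \<open>antimono h\<close>] by (intro sum_mono mult_left_mono) auto
  also have "\<dots> \<le> 2 * A 0"
    using sum[of k] A(1)[of "Suc k"] by (smt (verit) divide_nonneg_pos zero_less_power)
  finally show ?thesis .
qed

section \<open>The iteration at one fixed noise level\<close>

text \<open>The noisy data \<open>g\<close> is frozen, and the fidelity enters only through
  \<open>H_cong\<close> and the noise bound, so that both choices of \<open>H\<close> are covered at
  once.\<close>

locale mhdm =
  fixes \<Omega> :: "(real^2) set" and T :: "img \<Rightarrow> img" and H :: "img \<Rightarrow> img \<Rightarrow> ennreal"
    and J :: "img \<Rightarrow> ennreal" and f z g :: img and lam :: "nat \<Rightarrow> real"
    and u :: "nat \<Rightarrow> img" and \<delta> :: real
  assumes T: "bounded_linear_L2 \<Omega> T"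
    and f_pos: "AE p in lebesgue_on \<Omega>. 0 < f p"
    and J_proper: "proper_functional \<Omega> J"
    and J_mult: "multiplicative_penalty \<Omega> J"
    and z: "z \<in> L2 \<Omega>" "AE p in lebesgue_on \<Omega>. T z p = f p" "J z < \<infinity>"
    and H_cong: "\<And>w w'. AE p in lebesgue_on \<Omega>. w p = w' p \<Longrightarrow> H g w = H g w'"
    and noise: "H g f \<le> ennreal (\<delta>\<^sup>2)"
    and lam_0: "0 < lam 0" and lam_Suc: "\<And>k. lam (Suc k) = 2 * lam k"
    and factors: "mhdm_factors \<Omega> T H J lam g u"
begin

lemma lam_pos: "0 < lam k"
  by (induction k) (use lam_0 lam_Suc in auto)

lemmas J_props = J_mult[unfolded multiplicative_penalty_def]

lemmas dom_mult = J_props[THEN conjunct1, rule_format, THEN conjunct1]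
  and J_mult_le = J_props[THEN conjunct1, rule_format, THEN conjunct2]
  and dom_nonzero = J_props[THEN conjunct2, THEN conjunct1, rule_format, THEN conjunct1]
  and dom_inverse = J_props[THEN conjunct2, THEN conjunct1, rule_format, THEN conjunct2, THEN conjunct1]
  and J_inverse = J_props[THEN conjunct2, THEN conjunct1, rule_format, THEN conjunct2, THEN conjunct2, symmetric]
  and J_one = J_props[THEN conjunct2, THEN conjunct2]

lemma one_in_dom: "(\<lambda>p. 1) \<in> dom_J \<Omega> J"
  using one_in_L2[OF J_proper J_mult] by (simp add: dom_J_def J_one)

lemma z_in_dom: "z \<in> dom_J \<Omega> J"
  using z by (simp add: dom_J_def)

lemma factor_admissible: "mhdm_admissible \<Omega> T (mhdm_prev u k) (u k)"
  using factors by (simp add: mhdm_factors_def is_arg_min_def)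

lemma factor_minimal:
  assumes "mhdm_admissible \<Omega> T (mhdm_prev u k) v"
  shows "mhdm_energy T H J g (lam k) (mhdm_prev u k) (u k)
    \<le> mhdm_energy T H J g (lam k) (mhdm_prev u k) v"
  using factors assms by (auto simp: mhdm_factors_def is_arg_min_def not_less)

lemma prev_0: "mhdm_prev u 0 = (\<lambda>p. 1)"
  by (simp add: mhdm_prev_def)

lemma prev_Suc: "mhdm_prev u (Suc k) = mhdm_iterate u k"
  by (simp add: mhdm_prev_def)

lemma iterate_eq: "mhdm_iterate u k = (\<lambda>p. u k p * mhdm_prev u k p)"
  by (cases k) (simp_all add: mhdm_prev_def mhdm_iterate_def mult.commute)

lemma iterate_L2: "mhdm_iterate u k \<in> L2 \<Omega>"
  using factor_admissible[of k] by (simp add: mhdm_admissible_def iterate_eq)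

lemma T_iterate_pos: "AE p in lebesgue_on \<Omega>. 0 < T (mhdm_iterate u k) p"
  using factor_admissible[of k] by (simp add: mhdm_admissible_def iterate_eq)

text \<open>The factor that would turn x_(k-1) into the true image; in particular
  \<open>rest 0\<close> is \<open>z\<close>. Writing it as a product with a reciprocal lets the
  closure properties of the domain of \<open>J\<close> apply directly.\<close>

definition rest :: "nat \<Rightarrow> img" where
  "rest k = (\<lambda>p. z p * (1 / mhdm_prev u k p))"

lemma rest_in_dom: "mhdm_prev u k \<in> dom_J \<Omega> J \<Longrightarrow> rest k \<in> dom_J \<Omega> J"
  unfolding rest_def by (intro dom_mult dom_inverse z_in_dom)

lemma energy_le_rest:
  assumes dom: "mhdm_prev u k \<in> dom_J \<Omega> J"
  shows "ennreal (lam k) * H g (T (mhdm_iterate u k)) + J (u k)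
    \<le> ennreal (lam k) * ennreal (\<delta>\<^sup>2) + J (rest k)"
proof -
  let ?w = "\<lambda>p. rest k p * mhdm_prev u k p"
  have w: "?w \<in> L2 \<Omega>"
    using dom_mult[OF rest_in_dom[OF dom] dom] by (simp add: dom_J_def)
  \<comment> \<open>Only a.e., because x_(k-1) may vanish on a null set; hence the passage through
    \<open>bounded_linear_L2_cong_AE\<close> and \<open>H_cong\<close>.\<close>
  have "AE p in lebesgue_on \<Omega>. ?w p = z p"
    using dom_nonzero[OF dom] by eventually_elim (simp add: rest_def)
  from bounded_linear_L2_cong_AE[OF T w z(1) this] z(2)
  have Tw: "AE p in lebesgue_on \<Omega>. T ?w p = f p" by eventually_elim simp
  with f_pos have "AE p in lebesgue_on \<Omega>. 0 < T ?w p" by eventually_elim simp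
  with w rest_in_dom[OF dom] have "mhdm_admissible \<Omega> T (mhdm_prev u k) (rest k)"
    by (simp add: mhdm_admissible_def dom_J_def)
  from factor_minimal[OF this]
  have "ennreal (lam k) * H g (T (mhdm_iterate u k)) + J (u k)
      \<le> ennreal (lam k) * H g (T ?w) + J (rest k)"
    by (simp add: mhdm_energy_def iterate_eq)
  also have "H g (T ?w) = H g f" by (rule H_cong[OF Tw])
  also have "ennreal (lam k) * H g f + J (rest k) \<le> ennreal (lam k) * ennreal (\<delta>\<^sup>2) + J (rest k)"
    by (intro add_right_mono mult_left_mono noise) simp
  finally show ?thesis .
qed

lemma energy_finite:
  assumes "mhdm_prev u k \<in> dom_J \<Omega> J"
  shows "ennreal (lam k) * H g (T (mhdm_iterate u k)) + J (u k) < \<infinity>"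
proof -
  have "ennreal (lam k) * ennreal (\<delta>\<^sup>2) + J (rest k) < \<infinity>"
    using rest_in_dom[OF assms] by (simp add: dom_J_def ennreal_mult_less_top)
  with energy_le_rest[OF assms] show ?thesis by (rule le_less_trans)
qed

text \<open>Admissibility alone does not bound \<open>J\<close>. If x_(k-1) has finite penalty,
  comparison with \<open>rest k\<close> makes the minimal energy finite, hence J(u_k) is finite and
  x_k stays in the domain.\<close>

lemma prev_in_dom: "mhdm_prev u k \<in> dom_J \<Omega> J"
proof (induction k)
  case 0
  show ?case using one_in_dom by (simp add: prev_0)
next
  case (Suc k)
  have "u k \<in> dom_J \<Omega> J"
    using energy_finite[OF Suc] factor_admissible[of k] by (simp add: dom_J_def mhdm_admissible_def)
  from dom_mult[OF this Suc] show ?case by (simp add: prev_Suc iterate_eq)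
qed

lemma factor_in_dom: "u k \<in> dom_J \<Omega> J"
  using energy_finite[OF prev_in_dom, of k] factor_admissible[of k]
  by (simp add: dom_J_def mhdm_admissible_def)

text \<open>Positivity of \<open>lam k\<close> matters: in \<open>ennreal\<close> a zero weight
  would hide an infinite fidelity.\<close>

lemma H_iterate_finite: "H g (T (mhdm_iterate u k)) < \<infinity>"
  using energy_finite[OF prev_in_dom, of k] lam_pos[of k]
  by (force simp: ennreal_mult_less_top)

lemma J_rest_Suc_le: "J (rest (Suc k)) \<le> J (rest k) + J (u k)"
proof -
  \<comment> \<open>This holds at every point: where a denominator vanishes, total division makes
    both sides 0.\<close>
  have "rest (Suc k) = (\<lambda>p. rest k p * (1 / u k p))"
    by (simp add: rest_def prev_Suc iterate_eq field_simps)
  then show ?thesis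
    using J_mult_le[OF rest_in_dom[OF prev_in_dom] dom_inverse[OF factor_in_dom], of k k]
    by (simp add: J_inverse[OF factor_in_dom])
qed

text \<open>The competitor 1 has no penalty and reproduces the previous iterate.\<close>

lemma H_iterate_Suc_le: "H g (T (mhdm_iterate u (Suc k))) \<le> H g (T (mhdm_iterate u k))"
proof -
  have "mhdm_admissible \<Omega> T (mhdm_prev u (Suc k)) (\<lambda>p. 1)"
    using one_in_dom iterate_L2[of k] T_iterate_pos[of k]
    by (simp add: mhdm_admissible_def dom_J_def prev_Suc)
  from factor_minimal[OF this]
  have "ennreal (lam (Suc k)) * H g (T (mhdm_iterate u (Suc k))) + J (u (Suc k))
      \<le> ennreal (lam (Suc k)) * H g (T (mhdm_iterate u k))"
    by (simp add: mhdm_energy_def iterate_eq[of "Suc k"] prev_Suc J_one)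
  then have "ennreal (lam (Suc k)) * H g (T (mhdm_iterate u (Suc k)))
      \<le> ennreal (lam (Suc k)) * H g (T (mhdm_iterate u k))"
    by (rule order_trans[OF add_increasing2[OF zero_le order_refl]])
  with lam_pos[of "Suc k"] show ?thesis by (simp add: ennreal_mult_le_mult_iff)
qed

text \<open>All quantities involved are finite, so the estimates move from \<open>ennreal\<close> to
  the reals, where the subtraction in \<open>doubling_telescope\<close> is meaningful.\<close>

lemma H_iterate_le:
  "H g (T (mhdm_iterate u k)) \<le> ennreal (\<delta>\<^sup>2 + 2 * enn2real (J z) / (lam 0 * (real k + 1)))"
proof -
  define h where "h = (\<lambda>k. enn2real (H g (T (mhdm_iterate u k))))"
  define A where "A = (\<lambda>k. enn2real (J (rest k)))"
  define j where "j = (\<lambda>k. enn2real (J (u k)))"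
  have h: "H g (T (mhdm_iterate u k)) = ennreal (h k)" for k
    using H_iterate_finite[of k] by (simp add: h_def)
  have A: "J (rest k) = ennreal (A k)" for k
    using rest_in_dom[OF prev_in_dom, of k] by (simp add: A_def dom_J_def)
  have j: "J (u k) = ennreal (j k)" for k
    using factor_in_dom[of k] by (simp add: j_def dom_J_def)
  have nonneg: "0 \<le> h k" "0 \<le> A k" "0 \<le> j k" for k by (simp_all add: h_def A_def j_def)
  have "lam 0 * (real k + 1) * (h k - \<delta>\<^sup>2) \<le> 2 * A 0"
  proof (rule doubling_telescope[where j = j])
    fix k
    show "lam k * h k + j k \<le> lam k * \<delta>\<^sup>2 + A k"
      using energy_le_rest[OF prev_in_dom, of k] lam_pos[of k] nonneg[of k]
      by (simp add: h A j flip: ennreal_mult ennreal_plus)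
    show "A (Suc k) \<le> A k + j k"
      using J_rest_Suc_le[of k] nonneg[of k] by (simp add: A j flip: ennreal_plus)
    show "h (Suc k) \<le> h k"
      using H_iterate_Suc_le[of k] nonneg[of k] by (simp add: h)
  qed (use lam_0 lam_Suc nonneg in auto)
  moreover have "A 0 = enn2real (J z)" by (simp add: A_def rest_def prev_0)
  moreover have "0 < lam 0 * (real k + 1)" using lam_0 by simp
  ultimately have "h k - \<delta>\<^sup>2 \<le> 2 * enn2real (J z) / (lam 0 * (real k + 1))"
    by (simp only: pos_le_divide_eq mult.commute)
  then have "h k \<le> \<delta>\<^sup>2 + 2 * enn2real (J z) / (lam 0 * (real k + 1))" by simp
  then show ?thesis unfolding h by (rule ennreal_leI)
qed

text \<open>Makes the \<open>Max\<close> in \<open>k_star\<close> meaningful. On the set, (\<tau> -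
  1) * \<delta>^2 is at most a constant over k + 1, which bounds k because the left side is
  positive.\<close>

lemma finite_stop_set:
  assumes "0 < \<delta>" "1 < \<tau>"
  shows "finite (stop_set T H \<tau> \<delta> g u)"
proof -
  let ?c = "2 * enn2real (J z) / (lam 0 * ((\<tau> - 1) * \<delta>\<^sup>2))"
  have "k \<le> nat \<lceil>?c\<rceil>" if "k \<in> stop_set T H \<tau> \<delta> g u" for k
  proof -
    let ?b = "\<delta>\<^sup>2 + 2 * enn2real (J z) / (lam 0 * (real k + 1))"
    have "ennreal (\<tau> * \<delta>\<^sup>2) \<le> ennreal ?b"
      using that H_iterate_le[of k] by (auto simp: stop_set_def)
    moreover have "0 \<le> ?b" using lam_0 by simp
    ultimately have "\<tau> * \<delta>\<^sup>2 \<le> ?b" by simp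
    then have "(\<tau> - 1) * \<delta>\<^sup>2 \<le> 2 * enn2real (J z) / (lam 0 * (real k + 1))"
      by (simp add: algebra_simps)
    moreover have "0 < lam 0 * (real k + 1)" using lam_0 by simp
    ultimately have "(\<tau> - 1) * \<delta>\<^sup>2 * (lam 0 * (real k + 1)) \<le> 2 * enn2real (J z)"
      by (simp only: pos_le_divide_eq)
    moreover have "0 < lam 0 * ((\<tau> - 1) * \<delta>\<^sup>2)" using assms lam_0 by simp
    ultimately have "real k + 1 \<le> ?c" by (simp only: pos_le_divide_eq ac_simps)
    then show ?thesis by linarith
  qed
  then show ?thesis by (meson finite_nat_set_iff_bounded_le)
qed

end

section \<open>From vanishing fidelity to a.e. convergence\<close>

text \<open>By nonnegativity the integrals are L1 norms, and L1 convergence gives a.e. convergence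
  of a subsequence. Finiteness for each n supplies integrability of every member.\<close>

lemma nn_integral_tendsto_0_AE_subseq:
  fixes F :: "nat \<Rightarrow> 'a \<Rightarrow> real"
  assumes [measurable]: "\<And>n. F n \<in> borel_measurable M"
    and nonneg: "\<And>n. AE x in M. 0 \<le> F n x"
    and fin: "\<And>n. (\<integral>\<^sup>+x. ennreal (F n x) \<partial>M) < \<infinity>"
    and lim: "(\<lambda>n. \<integral>\<^sup>+x. ennreal (F n x) \<partial>M) \<longlonglongrightarrow> 0"
  shows "\<exists>r::nat \<Rightarrow> nat. strict_mono r \<and> (AE x in M. (\<lambda>n. F (r n) x) \<longlonglongrightarrow> 0)"
proof (rule tendsto_L1_AE_subseq)
  have eq: "(\<integral>\<^sup>+x. ennreal (norm (F n x)) \<partial>M) = (\<integral>\<^sup>+x. ennreal (F n x) \<partial>M)" for n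
    by (rule nn_integral_cong_AE[OF eventually_mono[OF nonneg[of n]]]) simp
  show int: "integrable M (F n)" for n
    by (intro integrableI_bounded) (use fin[of n] in \<open>simp_all only: eq assms(1)\<close>)
  have "ennreal (\<integral>x. norm (F n x) \<partial>M) = (\<integral>\<^sup>+x. ennreal (F n x) \<partial>M)" for n
    using nn_integral_eq_integral[OF integrable_norm[OF int[of n]]] eq[of n] by simp
  with lim have "(\<lambda>n. ennreal (\<integral>x. norm (F n x) \<partial>M)) \<longlonglongrightarrow> ennreal 0" by simp
  then show "(\<lambda>n. \<integral>x. norm (F n x) \<partial>M) \<longlonglongrightarrow> 0"
    by (subst (asm) tendsto_ennreal_iff) simp_all
qed

text \<open>Applying ln s \<le> s - 1 at s = sqrt t gives (sqrt t - 1)^2 \<le> t - ln t - 1, so sqrt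
  t is squeezed to 1.\<close>

lemma tendsto_1_if_diff_ln_tendsto_0:
  fixes t :: "nat \<Rightarrow> real"
  assumes pos: "\<And>n. 0 < t n" and lim: "(\<lambda>n. t n - ln (t n) - 1) \<longlonglongrightarrow> 0"
  shows "t \<longlonglongrightarrow> 1"
proof -
  have bound: "(sqrt (t n) - 1)\<^sup>2 \<le> t n - ln (t n) - 1" for n
  proof -
    have "ln (t n) = 2 * ln (sqrt (t n))" using pos[of n] by (simp add: ln_sqrt)
    also have "\<dots> \<le> 2 * (sqrt (t n) - 1)" using ln_le_minus_one[of "sqrt (t n)"] pos[of n] by simp
    finally show ?thesis using pos[of n] by (simp add: power2_diff)
  qed
  have "(\<lambda>n. (sqrt (t n) - 1)\<^sup>2) \<longlonglongrightarrow> 0"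
    by (rule tendsto_sandwich[OF _ _ tendsto_const lim]) (use bound in auto)
  then have "(\<lambda>n. (sqrt (t n) - 1 + 1)\<^sup>2) \<longlonglongrightarrow> (0 + 1)\<^sup>2"
    by (intro tendsto_intros) simp
  moreover have "(sqrt (t n) - 1 + 1)\<^sup>2 = t n" for n using pos[of n] by simp
  ultimately show ?thesis by simp
qed

lemma H_tendsto_0_AE_subseq:
  assumes H: "H = H_quot \<Omega> \<or> H = H_log \<Omega>"
    and meas [measurable]: "\<And>n. g n \<in> borel_measurable (lebesgue_on \<Omega>)"
      "\<And>n. w n \<in> borel_measurable (lebesgue_on \<Omega>)"
    and g: "\<And>n. AE p in lebesgue_on \<Omega>. 0 < g n p" and w: "\<And>n. AE p in lebesgue_on \<Omega>. 0 < w n p"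
    and fin: "\<And>n. H (g n) (w n) < \<infinity>" and lim: "(\<lambda>n. H (g n) (w n)) \<longlonglongrightarrow> 0"
  shows "\<exists>r::nat \<Rightarrow> nat. strict_mono r \<and>
    (AE p in lebesgue_on \<Omega>. (\<lambda>n. g (r n) p / w (r n) p) \<longlonglongrightarrow> 1)"
  using H
proof
  assume H: "H = H_quot \<Omega>"
  have "\<exists>r::nat \<Rightarrow> nat. strict_mono r \<and>
      (AE p in lebesgue_on \<Omega>. (\<lambda>n. (g (r n) p / w (r n) p - 1)\<^sup>2) \<longlonglongrightarrow> 0)"
    using fin lim unfolding H H_quot_def by (intro nn_integral_tendsto_0_AE_subseq) auto
  then obtain r :: "nat \<Rightarrow> nat" where r: "strict_mono r"
    and "AE p in lebesgue_on \<Omega>. (\<lambda>n. (g (r n) p / w (r n) p - 1)\<^sup>2) \<longlonglongrightarrow> 0" by blast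
  from this(2) have "AE p in lebesgue_on \<Omega>. (\<lambda>n. g (r n) p / w (r n) p) \<longlonglongrightarrow> 1"
  proof eventually_elim
    case (elim p)
    then have "(\<lambda>n. g (r n) p / w (r n) p - 1) \<longlonglongrightarrow> 0" by simp
    then show ?case by (simp add: LIM_zero_iff)
  qed
  with r show ?thesis by blast
next
  assume H: "H = H_log \<Omega>"
  \<comment> \<open>For positive data the logarithmic integrand depends only on the ratio t = g / w,
    as t - ln t - 1.\<close>
  let ?F = "\<lambda>n p. g n p / w n p - ln (g n p / w n p) - 1"
  have pos: "AE p in lebesgue_on \<Omega>. \<forall>n. 0 < g n p \<and> 0 < w n p"
    using g w by (simp add: AE_all_countable)
  have eq: "H (g n) (w n) = (\<integral>\<^sup>+p. ennreal (?F n p) \<partial>lebesgue_on \<Omega>)" for n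
    unfolding H H_log_def
  proof (rule nn_integral_cong_AE)
    show "AE p in lebesgue_on \<Omega>. ennreal (g n p / w n p + ln (w n p) - ln (g n p) - 1) = ennreal (?F n p)"
      using pos
    proof eventually_elim
      case (elim p)
      then have "0 < g n p" "0 < w n p" by auto
      then show ?case by (simp add: ln_div algebra_simps)
    qed
  qed
  have "\<exists>r::nat \<Rightarrow> nat. strict_mono r \<and> (AE p in lebesgue_on \<Omega>. (\<lambda>n. ?F (r n) p) \<longlonglongrightarrow> 0)"
  proof (rule nn_integral_tendsto_0_AE_subseq)
    show "AE p in lebesgue_on \<Omega>. 0 \<le> ?F n p" for n
      using pos
    proof eventually_elim
      case (elim p)
      then have "0 < g n p / w n p" by simp
      then show ?case using ln_le_minus_one[of "g n p / w n p"] by simp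
    qed
  qed (use fin lim in \<open>simp_all add: eq\<close>)
  then obtain r :: "nat \<Rightarrow> nat" where r: "strict_mono r"
    and "AE p in lebesgue_on \<Omega>. (\<lambda>n. ?F (r n) p) \<longlonglongrightarrow> 0" by blast
  from this(2) pos have "AE p in lebesgue_on \<Omega>. (\<lambda>n. g (r n) p / w (r n) p) \<longlonglongrightarrow> 1"
    by eventually_elim (rule tendsto_1_if_diff_ln_tendsto_0, auto)
  with r show ?thesis by blast
qed

text \<open>The noisy data serves as a bridge: g / w and g / f both tend to 1, and w = f * (g / f) /
  (g / w). The second subsequence is extracted from the first.\<close>

lemma H_both_tendsto_0_AE_subseq:
  assumes H: "H = H_quot \<Omega> \<or> H = H_log \<Omega>"
    and meas: "\<And>n. g n \<in> borel_measurable (lebesgue_on \<Omega>)"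
      "\<And>n. w n \<in> borel_measurable (lebesgue_on \<Omega>)" "f \<in> borel_measurable (lebesgue_on \<Omega>)"
    and g: "\<And>n. AE p in lebesgue_on \<Omega>. 0 < g n p" and w: "\<And>n. AE p in lebesgue_on \<Omega>. 0 < w n p"
    and f: "AE p in lebesgue_on \<Omega>. 0 < f p"
    and fin: "\<And>n. H (g n) (w n) < \<infinity>" "\<And>n. H (g n) f < \<infinity>"
    and lim: "(\<lambda>n. H (g n) (w n)) \<longlonglongrightarrow> 0" "(\<lambda>n. H (g n) f) \<longlonglongrightarrow> 0"
  shows "\<exists>r::nat \<Rightarrow> nat. strict_mono r \<and> (AE p in lebesgue_on \<Omega>. (\<lambda>n. w (r n) p) \<longlonglongrightarrow> f p)"
proof -
  obtain r :: "nat \<Rightarrow> nat" where r: "strict_mono r"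
    and gw: "AE p in lebesgue_on \<Omega>. (\<lambda>n. g (r n) p / w (r n) p) \<longlonglongrightarrow> 1"
    using H_tendsto_0_AE_subseq[OF H meas(1,2) g w fin(1) lim(1)] by blast
  have "(\<lambda>n. H (g (r n)) f) \<longlonglongrightarrow> 0"
    using LIMSEQ_subseq_LIMSEQ[OF lim(2) r] by (simp add: o_def)
  from H_tendsto_0_AE_subseq[OF H meas(1,3) g f fin(2) this]
  obtain s :: "nat \<Rightarrow> nat" where s: "strict_mono s"
    and gf: "AE p in lebesgue_on \<Omega>. (\<lambda>n. g (r (s n)) p / f p) \<longlonglongrightarrow> 1" by blast
  have "AE p in lebesgue_on \<Omega>. \<forall>n. 0 < g n p \<and> 0 < w n p"
    using g w by (simp add: AE_all_countable)
  with gw gf f have "AE p in lebesgue_on \<Omega>. (\<lambda>n. w (r (s n)) p) \<longlonglongrightarrow> f p"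
  proof eventually_elim
    case (elim p)
    have "(\<lambda>n. g (r (s n)) p / w (r (s n)) p) \<longlonglongrightarrow> 1"
      using LIMSEQ_subseq_LIMSEQ[OF elim(1) s] by (simp add: o_def)
    with elim(2) have "(\<lambda>n. f p * (g (r (s n)) p / f p / (g (r (s n)) p / w (r (s n)) p))) \<longlonglongrightarrow> f p * (1 / 1)"
      by (intro tendsto_intros) simp_all
    moreover have "f p * (g n p / f p / (g n p / w n p)) = w n p" for n
    proof -
      have "f p \<noteq> 0" "g n p \<noteq> 0" "w n p \<noteq> 0" using elim(3) elim(4) by (auto simp: less_imp_neq[symmetric])
      then show ?thesis by (simp add: field_simps)
    qed
    ultimately show ?case by simp
  qed
  moreover have "strict_mono (\<lambda>n. r (s n))" using strict_mono_o[OF r s] by (simp add: o_def)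
  ultimately show ?thesis by blast
qed

section \<open>Choice of noise levels and conclusion\<close>

text \<open>Unboundedness yields large values but not their order. Asking for a value above all
  those at indices up to n forces a new index beyond n.\<close>

lemma unbounded_subseq:
  fixes k :: "nat \<Rightarrow> nat"
  assumes "\<And>K. \<exists>n. P n \<and> K \<le> k n"
  shows "\<exists>r::nat \<Rightarrow> nat. strict_mono r \<and> (\<forall>n. P (r n) \<and> n \<le> k (r n))"
proof -
  have step: "\<exists>m>n. P m \<and> K \<le> k m" for n K
  proof -
    obtain m where m: "P m" "Suc (max K (Max (k ` {..n}))) \<le> k m" using assms by blast
    have "k i \<le> Max (k ` {..n})" if "i \<le> n" for i using that by (intro Max_ge) auto
    from this[of m] m(2) have "n < m" by linarith
    with m show ?thesis by (intro exI[of _ m]) auto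
  qed
  have "\<exists>r. \<forall>n. (P (r n) \<and> n \<le> k (r n)) \<and> r n < r (Suc n)"
    by (rule dependent_nat_choice) (use assms step in blast)+
  then show ?thesis unfolding strict_mono_Suc_iff by blast
qed

theorem proposition4p6:
  fixes \<Omega> :: "(real^2) set"
    and T :: "img \<Rightarrow> img"
    and H :: "img \<Rightarrow> img \<Rightarrow> ennreal"
    and J :: "img \<Rightarrow> ennreal"
    and f z :: img
    and f\<delta> :: "real \<Rightarrow> img"
    and lam :: "nat \<Rightarrow> real"
    and u :: "real \<Rightarrow> nat \<Rightarrow> img"
    and \<tau> :: real
    and d :: "nat \<Rightarrow> real"
  assumes "open \<Omega>" and "connected \<Omega>" and "\<Omega> \<noteq> {}"
    and "bounded_linear_L2 \<Omega> T"
    and "f \<in> L2 \<Omega>" and "AE p in lebesgue_on \<Omega>. 0 < f p"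
    and "proper_functional \<Omega> J"
    and "multiplicative_penalty \<Omega> J"
    and "z \<in> L2 \<Omega>" and "AE p in lebesgue_on \<Omega>. T z p = f p" and "J z < \<infinity>"
    and "H = H_quot \<Omega> \<or> H = H_log \<Omega>"
    and "\<And>\<delta>. 0 < \<delta> \<Longrightarrow> f\<delta> \<delta> \<in> borel_measurable (lebesgue_on \<Omega>)"
    and "\<And>\<delta>. 0 < \<delta> \<Longrightarrow> AE p in lebesgue_on \<Omega>. 0 < f\<delta> \<delta> p"
    and "\<And>\<delta>. 0 < \<delta> \<Longrightarrow> H (f\<delta> \<delta>) f \<le> ennreal (\<delta>\<^sup>2)"
    and "0 < lam 0" and "\<And>k. lam (Suc k) = 2 * lam k"
    and "\<And>\<delta>. 0 < \<delta> \<Longrightarrow> mhdm_factors \<Omega> T H J lam (f\<delta> \<delta>) (u \<delta>)"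
    and "1 < \<tau>"
    and "\<And>n. 0 < d n" and "d \<longlonglongrightarrow> 0"
    and "\<And>K. \<exists>n. stop_set T H \<tau> (d n) (f\<delta> (d n)) (u (d n)) \<noteq> {} \<and>
                K \<le> k_star T H \<tau> (d n) (f\<delta> (d n)) (u (d n))"
  shows "(\<exists>r. strict_mono r \<and>
           (\<forall>n. finite (stop_set T H \<tau> (d (r n)) (f\<delta> (d (r n))) (u (d (r n)))) \<and>
                stop_set T H \<tau> (d (r n)) (f\<delta> (d (r n))) (u (d (r n))) \<noteq> {}) \<and>
           (AE p in lebesgue_on \<Omega>.
              (\<lambda>n. T (mhdm_iterate (u (d (r n)))
                        (k_star T H \<tau> (d (r n)) (f\<delta> (d (r n))) (u (d (r n))))) p) \<longlonglongrightarrow> f p)) \<and>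
         ((\<forall>v\<in>L2 \<Omega>. AE p in lebesgue_on \<Omega>. T v p = v p) \<longrightarrow>
         (\<exists>r. strict_mono r \<and>
           (\<forall>n. finite (stop_set T H \<tau> (d (r n)) (f\<delta> (d (r n))) (u (d (r n)))) \<and>
                stop_set T H \<tau> (d (r n)) (f\<delta> (d (r n))) (u (d (r n))) \<noteq> {}) \<and>
           (AE p in lebesgue_on \<Omega>.
              (\<lambda>n. mhdm_iterate (u (d (r n)))
                     (k_star T H \<tau> (d (r n)) (f\<delta> (d (r n))) (u (d (r n)))) p) \<longlonglongrightarrow> z p)))"
proof -
  let ?M = "lebesgue_on \<Omega>"
  let ?S = "\<lambda>n. stop_set T H \<tau> (d n) (f\<delta> (d n)) (u (d n))"
  let ?k = "\<lambda>n. k_star T H \<tau> (d n) (f\<delta> (d n)) (u (d n))"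
  let ?x = "\<lambda>n. mhdm_iterate (u (d n)) (?k n)"
  note T = \<open>bounded_linear_L2 \<Omega> T\<close> and H = \<open>H = H_quot \<Omega> \<or> H = H_log \<Omega>\<close>
    and noise = \<open>\<And>\<delta>. 0 < \<delta> \<Longrightarrow> H (f\<delta> \<delta>) f \<le> ennreal (\<delta>\<^sup>2)\<close>
    and d_pos = \<open>\<And>n. 0 < d n\<close> and d_lim = \<open>d \<longlonglongrightarrow> 0\<close>
  have mhdm: "mhdm \<Omega> T H J f z (f\<delta> (d n)) lam (u (d n)) (d n)" for n
    unfolding mhdm_def using assms(4,6-11,16,17) H_cong_AE[OF H] noise[OF d_pos] assms(18)[OF d_pos]
    by blast
  have x_L2: "?x n \<in> L2 \<Omega>" for n by (rule mhdm.iterate_L2[OF mhdm])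
  \<comment> \<open>Along \<open>q\<close> the stopping index exists and is at least n, so the
    O(1/k) term of \<open>H_iterate_le\<close> vanishes in the limit.\<close>
  obtain q :: "nat \<Rightarrow> nat" where q: "strict_mono q" and qS: "\<And>n. ?S (q n) \<noteq> {} \<and> n \<le> ?k (q n)"
    using unbounded_subseq[of "\<lambda>n. ?S n \<noteq> {}" ?k] assms(22) by blast
  have dq: "(\<lambda>n. d (q n)) \<longlonglongrightarrow> 0"
    using LIMSEQ_subseq_LIMSEQ[OF d_lim q] by (simp add: o_def)
  define c where "c = 2 * enn2real (J z) / lam 0"
  have c: "0 \<le> c" using \<open>0 < lam 0\<close> by (simp add: c_def)
  have Hx_le: "H (f\<delta> (d (q n))) (T (?x (q n))) \<le> ennreal ((d (q n))\<^sup>2 + c / (real n + 1))" for n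
  proof -
    have "H (f\<delta> (d (q n))) (T (?x (q n))) \<le> ennreal ((d (q n))\<^sup>2 + c / (real (?k (q n)) + 1))"
      using mhdm.H_iterate_le[OF mhdm, of "q n" "?k (q n)"] by (simp add: c_def)
    also have "\<dots> \<le> ennreal ((d (q n))\<^sup>2 + c / (real n + 1))"
      using qS[of n] c by (intro ennreal_leI add_left_mono divide_left_mono) auto
    finally show ?thesis .
  qed
  have "(\<lambda>n. c / (real n + 1)) \<longlonglongrightarrow> 0"
    using LIMSEQ_Suc[OF lim_const_over_n[of c]] by (simp add: add.commute)
  with dq have "(\<lambda>n. ennreal ((d (q n))\<^sup>2 + c / (real n + 1))) \<longlonglongrightarrow> ennreal (0\<^sup>2 + 0)"
    by (intro tendsto_ennrealI tendsto_add tendsto_power)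
  then have bound_lim: "(\<lambda>n. ennreal ((d (q n))\<^sup>2 + c / (real n + 1))) \<longlonglongrightarrow> 0" by simp
  have Hx_lim: "(\<lambda>n. H (f\<delta> (d (q n))) (T (?x (q n)))) \<longlonglongrightarrow> 0"
    by (rule tendsto_sandwich[OF _ _ tendsto_const bound_lim]) (use Hx_le in auto)
  have "(\<lambda>n. ennreal ((d (q n))\<^sup>2)) \<longlonglongrightarrow> ennreal (0\<^sup>2)"
    using dq by (intro tendsto_ennrealI tendsto_power)
  then have noise_lim: "(\<lambda>n. ennreal ((d (q n))\<^sup>2)) \<longlonglongrightarrow> 0" by simp
  have Hf_lim: "(\<lambda>n. H (f\<delta> (d (q n))) f) \<longlonglongrightarrow> 0"
    by (rule tendsto_sandwich[OF _ _ tendsto_const noise_lim]) (use noise d_pos in auto)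
  have "\<exists>s::nat \<Rightarrow> nat. strict_mono s \<and> (AE p in ?M. (\<lambda>n. T (?x (q (s n))) p) \<longlonglongrightarrow> f p)"
  proof (rule H_both_tendsto_0_AE_subseq[OF H _ _ _ _ _ _ _ _ Hx_lim Hf_lim])
    show "T (?x (q n)) \<in> borel_measurable ?M" for n
      using T x_L2[of "q n"] by (auto simp: bounded_linear_L2_def L2_def)
    show "f \<in> borel_measurable ?M" using \<open>f \<in> L2 \<Omega>\<close> by (simp add: L2_def)
    show "AE p in ?M. 0 < T (?x (q n)) p" for n by (rule mhdm.T_iterate_pos[OF mhdm])
    show "H (f\<delta> (d (q n))) (T (?x (q n))) < \<infinity>" for n
      by (rule mhdm.H_iterate_finite[OF mhdm])
    show "H (f\<delta> (d (q n))) f < \<infinity>" for n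
      using noise[OF d_pos, of "q n"] by (rule le_less_trans) simp
  qed (use assms d_pos in auto)
  then obtain s :: "nat \<Rightarrow> nat" where s: "strict_mono s"
    and lim: "AE p in ?M. (\<lambda>n. T (?x (q (s n))) p) \<longlonglongrightarrow> f p" by blast
  define r where "r = (\<lambda>n. q (s n))"
  have r: "strict_mono r" using strict_mono_o[OF q s] by (simp add: o_def r_def)
  have S: "\<forall>n. finite (?S (r n)) \<and> ?S (r n) \<noteq> {}"
    using mhdm.finite_stop_set[OF mhdm d_pos \<open>1 < \<tau>\<close>] qS by (simp add: r_def)
  have T_lim: "AE p in ?M. (\<lambda>n. T (?x (r n)) p) \<longlonglongrightarrow> f p" using lim by (simp add: r_def)
  \<comment> \<open>In the denoising case \<open>T\<close> is the identity only up to null sets;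
    countably many iterates still share one exceptional null set.\<close>
  have x_lim: "AE p in ?M. (\<lambda>n. ?x (r n) p) \<longlonglongrightarrow> z p"
    if id: "\<forall>v\<in>L2 \<Omega>. AE p in ?M. T v p = v p"
  proof -
    have "AE p in ?M. T z p = z p" using id \<open>z \<in> L2 \<Omega>\<close> by blast
    moreover have "AE p in ?M. \<forall>n. T (?x (r n)) p = ?x (r n) p"
      using id x_L2 by (simp add: AE_all_countable)
    ultimately show ?thesis using T_lim \<open>AE p in ?M. T z p = f p\<close> by eventually_elim simp
  qed
  show ?thesis using r S T_lim x_lim by blast
qed

end
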